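(* For every $\varepsilon\in(0,1)$, every randomized $\varepsilon$-clairvoyant algorithm has competitive ratio at least $\frac{3}{2}$ for minimizing the total flow time on a single machine.
   Context: Single-machine preemptive online scheduling: jobs $j$ with release times $q_j\ge0$ and processing times $p_j>0$ arrive over time; at most one job is processed at any instant; objective total flow time $\sum_j(C_j-q_j)$. In the $\varepsilon$-clairvoyant model, $p_j$ is unknown when $j$ arrives and is revealed once the remaining processing time of $j$ is at most $\varepsilon p_j$. A randomized algorithm has competitive ratio at least $\rho$ if for every $\rho'<\rho$ there is an instance on which its expected total flow time exceeds $\rho'$ times the optimal total flow time. *)

theory Defs
  imports "HOL-Probability.Probability"
begin

record scheduling_instance =
  jobs :: "nat set"
  release :: "nat \<Rightarrow> real"
  proc_time :: "nat \<Rightarrow> real"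

definition valid_instance :: "scheduling_instance \<Rightarrow> bool" where
  "valid_instance I \<longleftrightarrow>
     finite (jobs I) \<and> (\<forall>j\<in>jobs I. 0 \<le> release I j \<and> 0 < proc_time I j)"

text \<open>The job processed at each instant, \<open>None\<close> meaning that the machine is idle.\<close>

type_synonym schedule = "real \<Rightarrow> nat option"

definition processed :: "schedule \<Rightarrow> nat \<Rightarrow> real \<Rightarrow> real" where
  "processed \<sigma> j t = measure lebesgue {s \<in> {0..t}. \<sigma> s = Some j}"

definition remaining :: "scheduling_instance \<Rightarrow> schedule \<Rightarrow> nat \<Rightarrow> real \<Rightarrow> real" where
  "remaining I \<sigma> j t = proc_time I j - processed \<sigma> j t"

definition feasible :: "scheduling_instance \<Rightarrow> schedule \<Rightarrow> bool" where
  "feasible I \<sigma> \<longleftrightarrow>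
     (\<forall>j. {t. \<sigma> t = Some j} \<in> sets lebesgue) \<and>
     (\<forall>t j. \<sigma> t = Some j \<longrightarrow> j \<in> jobs I \<and> release I j \<le> t \<and> 0 < remaining I \<sigma> j t)"

text \<open>A job that is never finished has completion time \<open>\<infinity>\<close> (the infimum of the empty set).\<close>

definition completion_time :: "scheduling_instance \<Rightarrow> schedule \<Rightarrow> nat \<Rightarrow> ennreal" where
  "completion_time I \<sigma> j = (INF t \<in> {t. 0 \<le> t \<and> remaining I \<sigma> j t \<le> 0}. ennreal t)"

definition total_flow_time :: "scheduling_instance \<Rightarrow> schedule \<Rightarrow> ennreal" where
  "total_flow_time I \<sigma> = (\<Sum>j\<in>jobs I. completion_time I \<sigma> j - ennreal (release I j))"

definition opt_flow_time :: "scheduling_instance \<Rightarrow> ennreal" where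
  "opt_flow_time I = (INF \<sigma> \<in> {\<sigma>. feasible I \<sigma>}. total_flow_time I \<sigma>)"

text \<open>
  What has become known by time \<open>t\<close> if \<open>I\<close> is processed according to \<open>\<sigma>\<close>: \<open>None\<close> for a job
  that has not arrived; otherwise its release time, together with its processing time if that
  has been revealed. The snapshot at \<open>t\<close> determines the snapshots at all earlier times.
\<close>

definition known_info ::
  "real \<Rightarrow> scheduling_instance \<Rightarrow> schedule \<Rightarrow> real \<Rightarrow> nat \<Rightarrow> (real \<times> real option) option" where
  "known_info \<epsilon> I \<sigma> t j =
     (if j \<in> jobs I \<and> release I j \<le> t
      then Some (release I j,
                 if remaining I \<sigma> j t \<le> \<epsilon> * proc_time I j then Some (proc_time I j) else None)
      else None)"

text \<open>
  A deterministic online algorithm is a map from instances to schedules whose decisions up to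
  time \<open>t\<close> depend only on what is known by time \<open>t\<close>. Both snapshots below are taken along the
  run on \<open>I\<close>. Requiring only that equal decisions before \<open>t\<close> and equal information imply an equal
  decision at \<open>t\<close> would be too weak in continuous time: two runs may differ without there being
  a first instant at which they differ.
\<close>

definition clairvoyant_algorithm ::
  "real \<Rightarrow> (scheduling_instance \<Rightarrow> schedule) \<Rightarrow> bool" where
  "clairvoyant_algorithm \<epsilon> A \<longleftrightarrow>
     (\<forall>I. valid_instance I \<longrightarrow> feasible I (A I)) \<and>
     (\<forall>I I' t. valid_instance I \<longrightarrow> valid_instance I' \<longrightarrow>
        known_info \<epsilon> I (A I) t = known_info \<epsilon> I' (A I) t \<longrightarrow>
        (\<forall>s\<in>{0..t}. A I s = A I' s))"

text \<open>
  A randomized algorithm is a random deterministic one: \<open>A \<omega>\<close> is the algorithm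
  obtained for the outcome \<open>\<omega>\<close> of the random choices.
\<close>

definition randomized_clairvoyant_algorithm ::
  "real \<Rightarrow> 'w measure \<Rightarrow> ('w \<Rightarrow> scheduling_instance \<Rightarrow> schedule) \<Rightarrow> bool" where
  "randomized_clairvoyant_algorithm \<epsilon> M A \<longleftrightarrow>
     prob_space M \<and>
     (\<forall>\<omega>\<in>space M. clairvoyant_algorithm \<epsilon> (A \<omega>)) \<and>
     (\<forall>I. valid_instance I \<longrightarrow> (\<lambda>\<omega>. total_flow_time I (A \<omega> I)) \<in> borel_measurable M)"

definition expected_flow_time ::
  "'w measure \<Rightarrow> ('w \<Rightarrow> scheduling_instance \<Rightarrow> schedule) \<Rightarrow> scheduling_instance \<Rightarrow> ennreal" where
  "expected_flow_time M A I = (\<integral>\<^sup>+ \<omega>. total_flow_time I (A \<omega> I) \<partial>M)"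

text \<open>Negative \<open>\<rho>'\<close> are truncated to \<open>0\<close> by \<open>ennreal\<close>; they add nothing when \<open>\<rho> > 0\<close>.\<close>

definition competitive_ratio_at_least ::
  "real \<Rightarrow> 'w measure \<Rightarrow> ('w \<Rightarrow> scheduling_instance \<Rightarrow> schedule) \<Rightarrow> bool" where
  "competitive_ratio_at_least \<rho> M A \<longleftrightarrow>
     (\<forall>\<rho>'<\<rho>. \<exists>I. valid_instance I \<and>
        expected_flow_time M A I > ennreal \<rho>' * opt_flow_time I)"

end

theory Submission
  imports Defs
begin

text \<open>
  Two jobs of sizes \<open>s\<close> and \<open>2 s\<close> arrive together, in an order decided by a fair coin, and the
  phase lasts exactly \<open>s\<close>. An optimal schedule finishes the short job. For the first \<open>(1 - \<epsilon>) s\<close>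
  units of work the two outcomes of the coin look alike to the algorithm, so in at least one of
  them a constant fraction of the short job is left over. After \<open>n\<close> such phases, whose lengths
  shrink so quickly that the leftovers survive all later phases, the algorithm has \<open>3 n / 2\<close>
  unfinished jobs on average against \<open>n\<close>. The flow time is the integral over time of the number of
  unfinished jobs, and a long stream of tiny jobs keeps these numbers from falling until they
  dominate everything else.
\<close>

subsection \<open>The work done on a job\<close>

definition measurable_schedule :: "schedule \<Rightarrow> bool" where
  "measurable_schedule \<sigma> \<longleftrightarrow> (\<forall>j. {t. \<sigma> t = Some j} \<in> sets lebesgue)"

lemma feasible_imp_measurable_schedule: "feasible I \<sigma> \<Longrightarrow> measurable_schedule \<sigma>"
  by (simp add: feasible_def measurable_schedule_def)

lemma lmeasurable_processing_times:
  assumes "measurable_schedule \<sigma>" and "S \<in> lmeasurable"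
  shows "{s \<in> S. \<sigma> s = Some j} \<in> lmeasurable"
proof -
  have "{s \<in> S. \<sigma> s = Some j} = S \<inter> {s. \<sigma> s = Some j}" by auto
  then show ?thesis using assms by (simp add: measurable_schedule_def fmeasurable_Int_fmeasurable)
qed

lemma processed_diff:
  assumes "measurable_schedule \<sigma>" and "u \<le> t"
  shows "processed \<sigma> j t - processed \<sigma> j u = measure lebesgue {s \<in> {0..t} - {0..u}. \<sigma> s = Some j}"
proof -
  have "measure lebesgue ({s \<in> {0..t}. \<sigma> s = Some j} - {s \<in> {0..u}. \<sigma> s = Some j})
      = processed \<sigma> j t - processed \<sigma> j u"
    unfolding processed_def using assms
    by (intro measurable_measure_Diff fmeasurableD lmeasurable_processing_times) auto
  moreover have "{s \<in> {0..t}. \<sigma> s = Some j} - {s \<in> {0..u}. \<sigma> s = Some j}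
      = {s \<in> {0..t} - {0..u}. \<sigma> s = Some j}" by auto
  ultimately show ?thesis by simp
qed

lemma processed_mono:
  assumes "measurable_schedule \<sigma>" and "u \<le> t"
  shows "processed \<sigma> j u \<le> processed \<sigma> j t"
proof -
  have "0 \<le> processed \<sigma> j t - processed \<sigma> j u"
    unfolding processed_diff[OF assms] by (rule measure_nonneg)
  then show ?thesis by simp
qed

lemma sum_processed_diff_le:
  assumes "measurable_schedule \<sigma>" and "u \<le> t" and "finite J"
  shows "(\<Sum>j\<in>J. processed \<sigma> j t - processed \<sigma> j u) \<le> t - u"
proof -
  let ?W = "\<lambda>j. {s \<in> {0..t} - {0..u}. \<sigma> s = Some j}"
  have meas: "?W j \<in> lmeasurable" for j
    using assms(1) by (intro lmeasurable_processing_times fmeasurable_Diff) auto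
  have "(\<Sum>j\<in>J. processed \<sigma> j t - processed \<sigma> j u) = (\<Sum>j\<in>J. measure lebesgue (?W j))"
    using processed_diff[OF assms(1,2)] by simp
  also have "\<dots> = measure lebesgue (\<Union>j\<in>J. ?W j)"
    using assms(3) meas by (intro measure_UNION'[symmetric]) (auto simp: pairwise_def disjnt_def)
  also have "\<dots> \<le> measure lebesgue {u..t}"
    using assms(3) meas by (intro measure_mono_fmeasurable sets.finite_UN fmeasurableD) auto
  also have "\<dots> = t - u" using assms(2) by simp
  finally show ?thesis .
qed

lemma processed_diff_le:
  assumes "measurable_schedule \<sigma>" and "u \<le> t"
  shows "processed \<sigma> j t - processed \<sigma> j u \<le> t - u"
  using sum_processed_diff_le[OF assms, of "{j}"] by simp

lemma processed_before_release:
  assumes "feasible I \<sigma>" and "t \<le> release I j"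
  shows "processed \<sigma> j t = 0"
proof -
  have "{s \<in> {0..t}. \<sigma> s = Some j} \<subseteq> {t}"
    using assms by (force simp: feasible_def)
  then have "negligible {s \<in> {0..t}. \<sigma> s = Some j}"
    using negligible_subset by blast
  then show ?thesis
    by (simp add: processed_def negligible_imp_measure0)
qed

lemma processed_cong:
  assumes "\<And>s. s \<in> {0..t} \<Longrightarrow> \<sigma> s = \<sigma>' s"
  shows "processed \<sigma> j t = processed \<sigma>' j t"
  using assms by (auto simp: processed_def intro!: arg_cong[where f = "measure lebesgue"])

subsection \<open>Flow time as an integral\<close>

definition active_jobs :: "scheduling_instance \<Rightarrow> schedule \<Rightarrow> real \<Rightarrow> nat set" where
  "active_jobs I \<sigma> t = {j \<in> jobs I. release I j \<le> t \<and> 0 < remaining I \<sigma> j t}"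

lemma less_completion_time_iff:
  assumes "measurable_schedule \<sigma>" and "0 \<le> t"
  shows "ennreal t < completion_time I \<sigma> j \<longleftrightarrow> 0 < remaining I \<sigma> j t"
proof
  assume unfinished: "ennreal t < completion_time I \<sigma> j"
  show "0 < remaining I \<sigma> j t"
  proof (rule ccontr)
    assume "\<not> 0 < remaining I \<sigma> j t"
    then have "completion_time I \<sigma> j \<le> ennreal t"
      unfolding completion_time_def using assms(2) by (intro INF_lower) auto
    then show False using unfinished by simp
  qed
next
  let ?r = "remaining I \<sigma> j t"
  assume unfinished: "0 < ?r"
  have "ennreal (t + ?r) \<le> completion_time I \<sigma> j"
    unfolding completion_time_def
  proof (rule INF_greatest)
    fix s assume "s \<in> {s. 0 \<le> s \<and> remaining I \<sigma> j s \<le> 0}"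
    then have finished: "remaining I \<sigma> j s \<le> 0" by simp
    have "t \<le> s"
      using processed_mono[OF assms(1), of s t j] finished unfinished
      by (cases "t \<le> s") (auto simp: remaining_def)
    then have "t + ?r \<le> s"
      using processed_diff_le[OF assms(1), of t s j] finished by (simp add: remaining_def)
    then show "ennreal (t + ?r) \<le> ennreal s" by (rule ennreal_leI)
  qed
  moreover have "ennreal t < ennreal (t + ?r)"
    using assms(2) unfinished by (intro ennreal_lessI) auto
  ultimately show "ennreal t < completion_time I \<sigma> j" by (rule less_le_trans[rotated])
qed

lemma emeasure_lborel_atLeast: "emeasure lborel {a::real..} = \<infinity>"
proof (cases "emeasure lborel {a..}")
  case (real x)
  have "emeasure lborel {a..a + (x + 1)} \<le> emeasure lborel {a..}"
    by (intro emeasure_mono) auto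
  then show ?thesis using real by simp
qed simp

lemma flow_time_eq_emeasure:
  assumes "measurable_schedule \<sigma>" and "0 \<le> release I j"
  shows "completion_time I \<sigma> j - ennreal (release I j)
    = emeasure lborel {t. release I j \<le> t \<and> 0 < remaining I \<sigma> j t}"
proof (cases "completion_time I \<sigma> j")
  case (real C)
  then have "0 < remaining I \<sigma> j t \<longleftrightarrow> t < C" if "release I j \<le> t" for t
    using that assms(2) less_completion_time_iff[OF assms(1), of t I j]
    by (simp add: ennreal_less_iff)
  then have "{t. release I j \<le> t \<and> 0 < remaining I \<sigma> j t} = {release I j..<C}"
    by auto
  moreover have "emeasure lborel {release I j..<C} = ennreal (C - release I j)"
    by (cases "release I j \<le> C") (simp_all add: ennreal_neg)
  ultimately show ?thesis
    using real assms(2) by (simp add: ennreal_minus)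
next
  case top
  then have "0 < remaining I \<sigma> j t" if "release I j \<le> t" for t
    using that assms(2) less_completion_time_iff[OF assms(1), of t I j] by simp
  then have "{t. release I j \<le> t \<and> 0 < remaining I \<sigma> j t} = {release I j..}"
    by auto
  then show ?thesis using top by (simp add: emeasure_lborel_atLeast)
qed

lemma borel_measurable_remaining:
  assumes "measurable_schedule \<sigma>"
  shows "remaining I \<sigma> j \<in> borel_measurable borel"
proof -
  have "processed \<sigma> j \<in> borel_measurable borel"
    using processed_mono[OF assms] by (intro borel_measurable_mono monoI)
  then have "(\<lambda>t. proc_time I j - processed \<sigma> j t) \<in> borel_measurable borel" by simp
  then show ?thesis unfolding remaining_def .
qed

lemma total_flow_time_eq_nn_integral:
  assumes "valid_instance I" and "measurable_schedule \<sigma>"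
  shows "total_flow_time I \<sigma> = (\<integral>\<^sup>+ t. of_nat (card (active_jobs I \<sigma> t)) \<partial>lborel)"
proof -
  let ?A = "\<lambda>j. {t. release I j \<le> t \<and> 0 < remaining I \<sigma> j t}"
  note [measurable] = borel_measurable_remaining[OF assms(2)]
  have "finite (jobs I)" using assms(1) by (simp add: valid_instance_def)
  then have card: "of_nat (card (active_jobs I \<sigma> t)) = (\<Sum>j\<in>jobs I. indicator (?A j) t :: ennreal)"
    for t
    by (simp add: active_jobs_def indicator_def sum.If_cases Int_def)
  have "total_flow_time I \<sigma> = (\<Sum>j\<in>jobs I. emeasure lborel (?A j))"
    using assms unfolding total_flow_time_def
    by (intro sum.cong flow_time_eq_emeasure) (auto simp: valid_instance_def)
  also have "\<dots> = (\<Sum>j\<in>jobs I. \<integral>\<^sup>+ t. indicator (?A j) t \<partial>lborel)"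
    by simp
  also have "\<dots> = (\<integral>\<^sup>+ t. (\<Sum>j\<in>jobs I. indicator (?A j) t) \<partial>lborel)"
    by (intro nn_integral_sum[symmetric]) simp
  finally show ?thesis by (simp add: card)
qed

lemma total_flow_time_ge_card_active:
  assumes "valid_instance I" and "measurable_schedule \<sigma>" and "a \<le> b"
    and active: "\<And>t. t \<in> {a..<b} \<Longrightarrow> k \<le> card (active_jobs I \<sigma> t)"
  shows "ennreal (real k * (b - a)) \<le> total_flow_time I \<sigma>"
proof -
  have "ennreal (real k * (b - a)) = (\<integral>\<^sup>+ t. of_nat k * indicator {a..<b} t \<partial>lborel)"
    using assms(3)
    by (simp add: nn_integral_cmult_indicator ennreal_mult ennreal_of_nat_eq_real_of_nat)
  also have "\<dots> \<le> (\<integral>\<^sup>+ t. of_nat (card (active_jobs I \<sigma> t)) \<partial>lborel)"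
    using active by (intro nn_integral_mono) (auto simp: indicator_def)
  also have "\<dots> = total_flow_time I \<sigma>"
    using total_flow_time_eq_nn_integral[OF assms(1,2)] by simp
  finally show ?thesis .
qed

lemma card_active_jobs_ge:
  assumes "measurable_schedule \<sigma>" and "u \<le> t" and "0 < p" and fin: "finite J" "finite (jobs I)"
    and released: "\<And>j. j \<in> J \<Longrightarrow> j \<in> jobs I \<and> release I j \<le> t"
    and large: "\<And>j. j \<in> J \<Longrightarrow> p \<le> remaining I \<sigma> j u"
  shows "real (card J) \<le> real (card (active_jobs I \<sigma> t)) + (t - u) / p"
proof -
  let ?finished = "{j \<in> J. remaining I \<sigma> j t \<le> 0}"
  have "p * real (card ?finished) = (\<Sum>j\<in>?finished. p)" by simp
  also have "\<dots> \<le> (\<Sum>j\<in>?finished. processed \<sigma> j t - processed \<sigma> j u)"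
    using large by (intro sum_mono) (force simp: remaining_def)
  also have "\<dots> \<le> t - u"
    using assms(1,2) fin(1) by (intro sum_processed_diff_le) auto
  finally have "real (card ?finished) \<le> (t - u) / p"
    using assms(3) by (simp add: field_simps)
  moreover have "card J \<le> card (active_jobs I \<sigma> t \<union> ?finished)"
    using released fin by (intro card_mono) (auto simp: active_jobs_def)
  then have "card J \<le> card (active_jobs I \<sigma> t) + card ?finished"
    using card_Un_le order_trans by blast
  ultimately show ?thesis by linarith
qed

subsection \<open>Nonpreemptive schedules\<close>

definition nonpreemptive_schedule :: "scheduling_instance \<Rightarrow> (nat \<Rightarrow> real) \<Rightarrow> schedule" where
  "nonpreemptive_schedule I S t =
     (if \<exists>j\<in>jobs I. t \<in> {S j..<S j + proc_time I j}
      then Some (THE j. j \<in> jobs I \<and> t \<in> {S j..<S j + proc_time I j}) else None)"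

lemma nonpreemptive_schedule_eq_Some_iff:
  assumes "disjoint_family_on (\<lambda>j. {S j..<S j + proc_time I j}) (jobs I)"
  shows "nonpreemptive_schedule I S t = Some j
    \<longleftrightarrow> j \<in> jobs I \<and> t \<in> {S j..<S j + proc_time I j}"
proof -
  have "k = l" if "k \<in> jobs I" "t \<in> {S k..<S k + proc_time I k}"
    "l \<in> jobs I" "t \<in> {S l..<S l + proc_time I l}" for k l
    using disjoint_family_onD[OF assms that(1,3)] that(2,4) by blast
  then have "(THE k. k \<in> jobs I \<and> t \<in> {S k..<S k + proc_time I k}) = l"
    if "l \<in> jobs I" "t \<in> {S l..<S l + proc_time I l}" for l
    using that by (intro the_equality) blast+
  then show ?thesis by (auto simp: nonpreemptive_schedule_def)
qed

lemma processed_nonpreemptive_schedule: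
  assumes "disjoint_family_on (\<lambda>j. {S j..<S j + proc_time I j}) (jobs I)"
    and "j \<in> jobs I" and "0 \<le> S j" and "S j \<le> t" and "t \<le> S j + proc_time I j"
  shows "processed (nonpreemptive_schedule I S) j t = t - S j"
proof -
  let ?W = "{s \<in> {0..t}. nonpreemptive_schedule I S s = Some j}"
  have "?W = {S j..<t} \<or> ?W = {S j..t}"
    using assms(2-) by (cases "t = S j + proc_time I j")
      (auto simp: nonpreemptive_schedule_eq_Some_iff[OF assms(1)])
  then have "measure lebesgue ?W = t - S j"
    using assms(4) by (elim disjE) (simp_all only:, simp_all)
  then show ?thesis by (simp add: processed_def)
qed

lemma feasible_nonpreemptive_schedule:
  assumes "disjoint_family_on (\<lambda>j. {S j..<S j + proc_time I j}) (jobs I)"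
    and "valid_instance I" and released: "\<And>j. j \<in> jobs I \<Longrightarrow> release I j \<le> S j"
  shows "feasible I (nonpreemptive_schedule I S)"
  unfolding feasible_def
proof (intro conjI allI impI)
  note eq_Some_iff = nonpreemptive_schedule_eq_Some_iff[OF assms(1)]
  fix j show "{t. nonpreemptive_schedule I S t = Some j} \<in> sets lebesgue"
  proof (cases "j \<in> jobs I")
    case True
    then have "{t. nonpreemptive_schedule I S t = Some j} = {S j..<S j + proc_time I j}"
      by (auto simp: eq_Some_iff)
    then show ?thesis by simp
  qed (simp add: eq_Some_iff)
next
  note eq_Some_iff = nonpreemptive_schedule_eq_Some_iff[OF assms(1)]
  fix t j assume "nonpreemptive_schedule I S t = Some j"
  then have j: "j \<in> jobs I" "S j \<le> t" "t < S j + proc_time I j"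
    by (simp_all add: eq_Some_iff)
  moreover have "0 \<le> release I j" using assms(2) j(1) by (simp add: valid_instance_def)
  ultimately show "j \<in> jobs I" "release I j \<le> t"
    "0 < remaining I (nonpreemptive_schedule I S) j t"
    using released[OF j(1)] processed_nonpreemptive_schedule[OF assms(1) j(1), of t]
    by (auto simp: remaining_def)
qed

lemma opt_flow_time_le_nonpreemptive:
  assumes "disjoint_family_on (\<lambda>j. {S j..<S j + proc_time I j}) (jobs I)"
    and "valid_instance I" and released: "\<And>j. j \<in> jobs I \<Longrightarrow> release I j \<le> S j"
  shows "opt_flow_time I \<le> ennreal (\<Sum>j\<in>jobs I. S j + proc_time I j - release I j)"
proof -
  let ?\<sigma> = "nonpreemptive_schedule I S"
  have valid: "0 \<le> release I j" "0 < proc_time I j" if "j \<in> jobs I" for j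
    using that assms(2) by (auto simp: valid_instance_def)
  have "opt_flow_time I \<le> total_flow_time I ?\<sigma>"
    unfolding opt_flow_time_def using feasible_nonpreemptive_schedule[OF assms]
    by (intro INF_lower) auto
  also have "\<dots> \<le> (\<Sum>j\<in>jobs I. ennreal (S j + proc_time I j - release I j))"
    unfolding total_flow_time_def
  proof (rule sum_mono)
    fix j assume j: "j \<in> jobs I"
    then have "0 \<le> S j" using released valid(1) order_trans by blast
    then have "completion_time I ?\<sigma> j \<le> ennreal (S j + proc_time I j)"
      unfolding completion_time_def
      using j valid(2)[OF j] processed_nonpreemptive_schedule[OF assms(1) j]
      by (intro INF_lower) (auto simp: remaining_def)
    then have "completion_time I ?\<sigma> j - ennreal (release I j)
        \<le> ennreal (S j + proc_time I j) - ennreal (release I j)"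
      by (intro ennreal_minus_mono) auto
    then show "completion_time I ?\<sigma> j - ennreal (release I j)
        \<le> ennreal (S j + proc_time I j - release I j)"
      using valid(1)[OF j] by (simp add: ennreal_minus)
  qed
  also have "\<dots> = ennreal (\<Sum>j\<in>jobs I. S j + proc_time I j - release I j)"
    using released valid by (intro sum_ennreal) (metis add_increasing2 diff_ge_0_iff_ge less_imp_le)
  finally show ?thesis .
qed

subsection \<open>Nonclairvoyance\<close>

lemma clairvoyant_algorithm_feasible:
  "clairvoyant_algorithm \<epsilon> A \<Longrightarrow> valid_instance I \<Longrightarrow> feasible I (A I)"
  by (simp add: clairvoyant_algorithm_def)

lemma clairvoyant_algorithm_cong:
  assumes "clairvoyant_algorithm \<epsilon> A" and "valid_instance I" and "valid_instance I'"
    and "jobs I' = jobs I" and "release I' = release I"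
    and unrevealed: "\<And>j. proc_time I j \<noteq> proc_time I' j \<Longrightarrow>
      processed (A I) j t < (1 - \<epsilon>) * proc_time I j \<and>
      processed (A I) j t < (1 - \<epsilon>) * proc_time I' j"
    and "s \<in> {0..t}"
  shows "A I s = A I' s"
proof -
  have "known_info \<epsilon> I (A I) t j = known_info \<epsilon> I' (A I) t j" for j
  proof (cases "proc_time I j = proc_time I' j")
    case True
    then show ?thesis using assms(4,5) by (simp add: known_info_def remaining_def)
  next
    case False
    then show ?thesis
      using unrevealed[of j] assms(4,5) by (simp add: known_info_def remaining_def algebra_simps)
  qed
  then show ?thesis
    using assms(1-3,7) unfolding clairvoyant_algorithm_def by blast
qed

text \<open>
  Up to time \<open>t0 + \<kappa>\<close> the two runs coincide and share \<open>\<kappa>\<close> units of work between \<open>a\<close> and \<open>b\<close>;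
  afterwards each run may devote itself to its own favourite.
\<close>

lemma processed_indistinguishable_le:
  assumes alg: "clairvoyant_algorithm \<epsilon> A" and valid: "valid_instance I" "valid_instance I'"
    and same: "jobs I' = jobs I" "release I' = release I"
      "\<And>j. j \<notin> {a, b} \<Longrightarrow> proc_time I j = proc_time I' j"
    and "a \<noteq> b" and released: "\<And>j. j \<in> {a, b} \<Longrightarrow> t0 \<le> release I j"
    and shared: "0 \<le> \<kappa>" "t0 + \<kappa> \<le> t"
    and large: "\<And>j. j \<in> {a, b} \<Longrightarrow> \<kappa> < (1 - \<epsilon>) * proc_time I j \<and> \<kappa> < (1 - \<epsilon>) * proc_time I' j"
  shows "processed (A I) a t + processed (A I') b t \<le> 2 * (t - t0) - \<kappa>"
proof -
  define u where "u = t0 + \<kappa>"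
  then have u: "t0 \<le> u" "u \<le> t" "u - t0 = \<kappa>" using shared by auto
  have feasible: "feasible I (A I)" "feasible I' (A I')"
    using clairvoyant_algorithm_feasible[OF alg] valid by auto
  note meas = feasible[THEN feasible_imp_measurable_schedule]
  have start: "processed (A I) j t0 = 0" if "j \<in> {a, b}" for j
    using released[OF that] by (intro processed_before_release[OF feasible(1)])
  have "processed (A I) j u \<le> \<kappa>" if "j \<in> {a, b}" for j
    using processed_diff_le[OF meas(1) u(1), of j] start[OF that] u(3) by simp
  then have "processed (A I) j u < (1 - \<epsilon>) * proc_time I j \<and>
      processed (A I) j u < (1 - \<epsilon>) * proc_time I' j" if "proc_time I j \<noteq> proc_time I' j" for j
    using that same(3) large by (meson order.strict_trans1)
  then have "A I s = A I' s" if "s \<in> {0..u}" for s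
    using clairvoyant_algorithm_cong[OF alg valid same(1,2) _ that] by blast
  then have "processed (A I') b u = processed (A I) b u"
    by (intro processed_cong) simp
  moreover have "processed (A I) a u + processed (A I) b u \<le> \<kappa>"
    using sum_processed_diff_le[OF meas(1) u(1), of "{a, b}"] start u(3) \<open>a \<noteq> b\<close> by simp
  moreover have "processed (A I) a t - processed (A I) a u \<le> t - u"
    "processed (A I') b t - processed (A I') b u \<le> t - u"
    using processed_diff_le meas u(2) by blast+
  ultimately show ?thesis using u(3) by argo
qed

subsection \<open>Averaging over instances\<close>

lemma card_Pow_le_double_card:
  assumes "finite S" and "i \<in> S"
    and pair: "\<And>B. B \<subseteq> S \<Longrightarrow> i \<notin> B \<Longrightarrow> P B \<or> P (insert i B)"
  shows "2 ^ card S \<le> 2 * card {B \<in> Pow S. P B}"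
proof -
  define flip where "flip B = (if i \<in> B then B - {i} else insert i B)" for B
  let ?G = "{B \<in> Pow S. P B}"
  have "finite ?G" using assms(1) by simp
  have "Pow S \<subseteq> ?G \<union> flip ` ?G"
  proof
    fix B assume "B \<in> Pow S"
    then have "P B \<or> P (flip B)"
      using pair[of B] pair[of "B - {i}"] by (cases "i \<in> B") (auto simp: flip_def insert_absorb)
    moreover have "flip B \<in> Pow S" "B = flip (flip B)"
      using \<open>B \<in> Pow S\<close> assms(2) by (auto simp: flip_def)
    ultimately show "B \<in> ?G \<union> flip ` ?G" using \<open>B \<in> Pow S\<close> by blast
  qed
  then have "card (Pow S) \<le> card (?G \<union> flip ` ?G)"
    using \<open>finite ?G\<close> by (intro card_mono) auto
  also have "\<dots> \<le> card ?G + card ?G"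
    using card_Un_le[of ?G "flip ` ?G"] card_image_le[OF \<open>finite ?G\<close>, of flip] by linarith
  finally show ?thesis using assms(1) by (simp add: card_Pow)
qed

text \<open>The easy direction of Yao's principle, for the uniform distribution on \<open>K\<close>.\<close>

lemma expected_flow_time_ge_average:
  assumes alg: "randomized_clairvoyant_algorithm \<epsilon> M A"
    and K: "finite K" "K \<noteq> {}" and valid: "\<And>k. k \<in> K \<Longrightarrow> valid_instance (I k)"
    and deterministic: "\<And>D. clairvoyant_algorithm \<epsilon> D \<Longrightarrow>
      of_nat (card K) * v \<le> (\<Sum>k\<in>K. total_flow_time (I k) (D (I k)))"
  obtains k where "k \<in> K" and "v \<le> expected_flow_time M A (I k)"
proof -
  interpret prob_space M using alg by (simp add: randomized_clairvoyant_algorithm_def)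
  let ?E = "\<lambda>k. expected_flow_time M A (I k)"
  have "Max (?E ` K) \<in> ?E ` K" using K by (intro Max_in) auto
  then obtain k where k: "k \<in> K" "Max (?E ` K) = ?E k" by blast
  have max: "?E l \<le> ?E k" if "l \<in> K" for l
    unfolding k(2)[symmetric] using K(1) that by (intro Max_ge) auto
  have "of_nat (card K) * v = (\<integral>\<^sup>+ \<omega>. of_nat (card K) * v \<partial>M)"
    by (simp add: emeasure_space_1)
  also have "\<dots> \<le> (\<integral>\<^sup>+ \<omega>. (\<Sum>k\<in>K. total_flow_time (I k) (A \<omega> (I k))) \<partial>M)"
    using alg
    by (intro nn_integral_mono deterministic) (simp add: randomized_clairvoyant_algorithm_def)
  also have "\<dots> = (\<Sum>k\<in>K. ?E k)"
    unfolding expected_flow_time_def using alg valid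
    by (intro nn_integral_sum) (simp add: randomized_clairvoyant_algorithm_def)
  also have "\<dots> \<le> of_nat (card K) * ?E k"
    using max by (rule sum_bounded_above)
  finally have "v \<le> ?E k"
    using K by (simp add: ennreal_mult_le_mult_iff card_eq_0_iff)
  then show ?thesis using that k(1) by blast
qed

subsection \<open>The adversary's instances\<close>

locale adversary =
  fixes \<epsilon> \<theta> :: real and n N :: nat
  assumes theta_pos: "0 < \<theta>" and theta_le: "\<theta> \<le> (1 - \<epsilon>) / 8" and eps_pos: "0 < \<epsilon>"
begin

definition phase_start :: "nat \<Rightarrow> real" where
  "phase_start i = (\<Sum>k<i. \<theta> ^ k)"

definition stream_length :: real where
  "stream_length = real N * \<theta> ^ n"

definition stream_end :: real where
  "stream_end = phase_start n + stream_length"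

text \<open>
  The jobs \<open>2 i\<close> and \<open>2 i + 1\<close> form phase \<open>i < n\<close>, and all later jobs form the stream, which
  counts as phase \<open>n\<close>. The adversary's coin flips are encoded as a set \<open>B\<close> of phases.
\<close>

definition phase :: "nat \<Rightarrow> nat" where
  "phase j = min (j div 2) n"

definition short_job :: "nat set \<Rightarrow> nat \<Rightarrow> nat" where
  "short_job B i = (if i \<in> B then 2 * i else 2 * i + 1)"

definition long_job :: "nat set \<Rightarrow> nat \<Rightarrow> nat" where
  "long_job B i = short_job (- B) i"

definition is_long :: "nat set \<Rightarrow> nat \<Rightarrow> bool" where
  "is_long B j \<longleftrightarrow> j < 2 * n \<and> j = long_job B (j div 2)"

text \<open>The truncated subtraction makes all jobs of a phase \<open>i < n\<close> arrive when the phase starts.\<close>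

definition arrival :: "nat \<Rightarrow> real" where
  "arrival j = phase_start (phase j) + real (j - 2 * n) * \<theta> ^ n"

definition job_size :: "nat set \<Rightarrow> nat \<Rightarrow> real" where
  "job_size B j = (if is_long B j then 2 else 1) * \<theta> ^ phase j"

definition inst :: "nat set \<Rightarrow> scheduling_instance" where
  "inst B = \<lparr>jobs = {..<2 * n + N}, release = arrival, proc_time = job_size B\<rparr>"

lemma inst_simps [simp]:
  "jobs (inst B) = {..<2 * n + N}" "release (inst B) = arrival" "proc_time (inst B) = job_size B"
  by (simp_all add: inst_def)

lemma theta_le_eighth: "\<theta> \<le> 1 / 8"
  using theta_le eps_pos by simp

lemma theta_power_pos [simp]: "0 < \<theta> ^ i"
  using theta_pos by simp

lemma phase_start_Suc: "phase_start (Suc i) = phase_start i + \<theta> ^ i"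
  by (simp add: phase_start_def)

lemma phase_start_mono: "i \<le> k \<Longrightarrow> phase_start i \<le> phase_start k"
  using theta_pos unfolding phase_start_def by (intro sum_mono2) auto

lemma phase_start_nonneg [simp]: "0 \<le> phase_start i"
  using theta_pos by (simp add: phase_start_def sum_nonneg)

lemma phase_start_add_power_antimono:
  "i \<le> k \<Longrightarrow> phase_start k + 2 * \<theta> ^ k \<le> phase_start i + 2 * \<theta> ^ i"
proof (induction k rule: dec_induct)
  case (step k)
  have "2 * \<theta> ^ Suc k \<le> \<theta> ^ k"
    using theta_le_eighth by simp
  then show ?case using step.IH unfolding phase_start_Suc by linarith
qed simp

lemma phase_start_add_power_le_2: "phase_start k + 2 * \<theta> ^ k \<le> 2"
  using phase_start_add_power_antimono[of 0 k] by (simp add: phase_start_def)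

lemma stream_length_nonneg [simp]: "0 \<le> stream_length"
  by (simp add: stream_length_def less_imp_le)

lemma phase_start_le_arrival: "phase_start (phase j) \<le> arrival j"
  by (simp add: arrival_def less_imp_le)

lemma phase_eq_div_2: "j < 2 * n \<Longrightarrow> phase j = j div 2"
  and phase_stream: "2 * n \<le> j \<Longrightarrow> phase j = n"
  by (simp_all add: phase_def)

lemma arrival_eq_phase_start: "j < 2 * n \<Longrightarrow> arrival j = phase_start (j div 2)"
  by (simp add: arrival_def phase_eq_div_2)

lemma arrival_le_phase_start: "j < 2 * n \<Longrightarrow> arrival j \<le> phase_start n"
  by (auto simp: arrival_eq_phase_start intro: phase_start_mono)

lemma job_size_pos: "0 < job_size B j"
  by (simp add: job_size_def)

lemma valid_inst: "valid_instance (inst B)"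
  using order_trans[OF phase_start_nonneg phase_start_le_arrival]
  by (simp add: valid_instance_def job_size_pos)

lemma short_job_div_2 [simp]: "short_job B i div 2 = i"
  and long_job_div_2 [simp]: "long_job B i div 2 = i"
  by (simp_all add: short_job_def long_job_def)

lemma short_job_less: "i < n \<Longrightarrow> short_job B i < 2 * n"
  and long_job_less: "i < n \<Longrightarrow> long_job B i < 2 * n"
  by (simp_all add: short_job_def long_job_def)

lemma short_long_job_set: "{short_job B i, long_job B i} = {2 * i, 2 * i + 1}"
  by (auto simp: short_job_def long_job_def)

lemma short_job_neq_long_job: "short_job B i \<noteq> long_job B i"
  by (simp add: short_job_def long_job_def)

lemma short_or_long_job: "j = short_job B (j div 2) \<or> j = long_job B (j div 2)"
  by (cases "even j") (simp_all add: short_job_def long_job_def)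

lemma is_long_long_job: "i < n \<Longrightarrow> is_long B (long_job B i)"
  and not_is_long_short_job: "\<not> is_long B (short_job B i)"
  by (simp_all add: is_long_def long_job_less short_job_neq_long_job)

lemma job_size_short_job: "i < n \<Longrightarrow> job_size B (short_job B i) = \<theta> ^ i"
  and job_size_long_job: "i < n \<Longrightarrow> job_size B (long_job B i) = 2 * \<theta> ^ i"
  by (simp_all add: job_size_def is_long_long_job not_is_long_short_job phase_eq_div_2
      short_job_less long_job_less)

subsection \<open>The offline schedule\<close>

definition offline_start :: "nat set \<Rightarrow> nat \<Rightarrow> real" where
  "offline_start B j =
     (if is_long B j then stream_end + 2 * phase_start (phase j) else arrival j)"

lemma arrival_le_offline_start: "arrival j \<le> offline_start B j"
proof (cases "is_long B j")
  case True
  then have "arrival j \<le> phase_start n" by (simp add: is_long_def arrival_le_phase_start)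
  moreover have "phase_start n \<le> stream_end" by (simp add: stream_end_def)
  ultimately show ?thesis using True by (simp add: offline_start_def add_increasing2)
qed (simp add: offline_start_def)

lemma offline_before_stream_end:
  assumes "\<not> is_long B j" and "j < 2 * n + N"
  shows "offline_start B j + job_size B j \<le> stream_end"
proof (cases "j < 2 * n")
  case True
  then have "phase_start (Suc (j div 2)) \<le> phase_start n" by (intro phase_start_mono) auto
  then show ?thesis
    using assms True
    by (simp add: offline_start_def job_size_def arrival_eq_phase_start phase_eq_div_2
        phase_start_Suc stream_end_def add_increasing2)
next
  case False
  then have "real (Suc (j - 2 * n)) * \<theta> ^ n \<le> stream_length"
    using assms unfolding stream_length_def by (intro mult_right_mono) (auto simp: less_imp_le)
  then show ?thesis
    using assms False
    by (simp add: offline_start_def job_size_def arrival_def phase_stream stream_end_def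
        algebra_simps)
qed

lemma offline_start_consecutive:
  assumes "j < k" and same: "is_long B j \<longleftrightarrow> is_long B k"
  shows "offline_start B j + job_size B j \<le> offline_start B k"
proof (cases "2 * n \<le> j")
  case True
  then have "real (Suc (j - 2 * n)) * \<theta> ^ n \<le> real (k - 2 * n) * \<theta> ^ n"
    using assms(1) by (intro mult_right_mono) (auto simp: less_imp_le)
  then show ?thesis
    using True assms(1)
    by (simp add: offline_start_def is_long_def job_size_def arrival_def phase_stream
        algebra_simps)
next
  case False
  have "phase j \<noteq> phase k"
  proof
    assume "phase j = phase k"
    then have "k div 2 = j div 2" "k div 2 < n"
      using False by (auto simp: phase_def min_def split: if_splits)
    moreover from this have "k < 2 * n" by simp
    ultimately show False
      using False assms short_or_long_job[of j B] short_or_long_job[of k B]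
      by (auto simp: is_long_def)
  qed
  then have "Suc (phase j) \<le> phase k"
    using div_le_mono[of j k 2] assms(1) by (auto simp: phase_def)
  then have "phase_start (phase j) + \<theta> ^ phase j \<le> phase_start (phase k)"
    using phase_start_mono by (metis phase_start_Suc)
  then show ?thesis
    using False same phase_start_le_arrival[of k]
    by (auto simp: offline_start_def job_size_def arrival_eq_phase_start phase_eq_div_2)
qed

lemma offline_intervals_disjoint:
  "disjoint_family_on (\<lambda>j. {offline_start B j..<offline_start B j + job_size B j}) {..<2 * n + N}"
proof -
  have "offline_start B j + job_size B j \<le> offline_start B k \<or>
      offline_start B k + job_size B k \<le> offline_start B j"
    if "j < k" "k < 2 * n + N" for j k
  proof (cases "is_long B j \<longleftrightarrow> is_long B k")
    case True
    then show ?thesis using that(1) offline_start_consecutive by blast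
  next
    case False
    have "stream_end \<le> offline_start B l" if "is_long B l" for l
      using that by (simp add: offline_start_def)
    then show ?thesis
      using False that offline_before_stream_end[of B j] offline_before_stream_end[of B k]
      by (meson less_trans order_trans)
  qed
  then have "{offline_start B j..<offline_start B j + job_size B j}
      \<inter> {offline_start B k..<offline_start B k + job_size B k} = {}"
    if "j \<noteq> k" "j < 2 * n + N" "k < 2 * n + N" for j k
    using that by (cases j k rule: linorder_cases) fastforce+
  then show ?thesis by (auto simp: disjoint_family_on_def)
qed

lemma offline_flow_time_phase:
  assumes "i < n"
  shows "(\<Sum>j\<in>{2 * i, 2 * i + 1}. offline_start B j + job_size B j - arrival j)
    \<le> stream_length + 5"
proof -
  let ?f = "\<lambda>j. offline_start B j + job_size B j - arrival j"
  have "(\<Sum>j\<in>{2 * i, 2 * i + 1}. ?f j) = ?f (short_job B i) + ?f (long_job B i)"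
    unfolding short_long_job_set[of B i, symmetric] using short_job_neq_long_job[of B i] by simp
  moreover have "?f (short_job B i) = \<theta> ^ i"
    using assms by (simp add: offline_start_def not_is_long_short_job job_size_short_job)
  moreover have "?f (long_job B i) = phase_start n + stream_length + (phase_start i + 2 * \<theta> ^ i)"
    using assms
    by (simp add: offline_start_def is_long_long_job job_size_long_job long_job_less
        arrival_eq_phase_start phase_eq_div_2 stream_end_def)
  ultimately show ?thesis
    using phase_start_add_power_le_2[of i] phase_start_add_power_le_2[of n] phase_start_nonneg[of i]
      theta_power_pos[of i] theta_power_pos[of n] by linarith
qed

lemma opt_flow_time_inst_le:
  "opt_flow_time (inst B) \<le> ennreal ((real n + 1) * stream_length + 5 * real n)"
proof -
  let ?f = "\<lambda>j. offline_start B j + job_size B j - arrival j"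
  have "opt_flow_time (inst B) \<le> ennreal (\<Sum>j<2 * n + N. ?f j)"
    using opt_flow_time_le_nonpreemptive[of "offline_start B" "inst B"]
    by (simp add: offline_intervals_disjoint valid_inst arrival_le_offline_start)
  also have "(\<Sum>j<2 * n + N. ?f j) = (\<Sum>j<2 * n. ?f j) + (\<Sum>j = 2 * n..<2 * n + N. ?f j)"
    by (simp add: sum.atLeastLessThan_concat flip: atLeast0LessThan)
  also have "(\<Sum>j<2 * n. ?f j) = (\<Sum>i<n. \<Sum>j\<in>{2 * i, 2 * i + 1}. ?f j)"
    using sum_split_even_odd[of ?f ?f n] by (simp add: sum.distrib)
  also have "\<dots> \<le> (\<Sum>i<n. stream_length + 5)"
    by (intro sum_mono offline_flow_time_phase) simp
  also have "(\<Sum>j = 2 * n..<2 * n + N. ?f j) = (\<Sum>j = 2 * n..<2 * n + N. \<theta> ^ n)"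
    by (intro sum.cong) (auto simp: offline_start_def is_long_def job_size_def phase_def)
  finally show ?thesis by (simp add: stream_length_def algebra_simps ennreal_leI)
qed

subsection \<open>Leftovers\<close>

definition missed_phases :: "nat set \<Rightarrow> schedule \<Rightarrow> nat set" where
  "missed_phases B \<sigma> = {i \<in> {..<n}.
     2 * \<theta> ^ Suc i \<le> remaining (inst B) \<sigma> (short_job B i) (phase_start (Suc i))}"

definition leftover :: "nat set \<Rightarrow> schedule \<Rightarrow> nat set" where
  "leftover B \<sigma> = {j. j < 2 * n \<and> \<theta> ^ n \<le> remaining (inst B) \<sigma> j (phase_start n)}"

lemma theta_power_le_job_size: "j < 2 * n \<Longrightarrow> \<theta> ^ (j div 2) \<le> job_size B j"
  by (simp add: job_size_def phase_eq_div_2)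

lemma job_size_insert: "j div 2 \<noteq> i \<Longrightarrow> job_size (insert i B) j = job_size B j"
  by (simp add: job_size_def is_long_def long_job_def short_job_def)

lemma missed_phase_or_missed_insert:
  assumes alg: "clairvoyant_algorithm \<epsilon> A" and "i < n" and "i \<notin> B"
  shows "i \<in> missed_phases B (A (inst B)) \<or>
    i \<in> missed_phases (insert i B) (A (inst (insert i B)))"
proof -
  let ?C = "insert i B" and ?\<kappa> = "(1 - \<epsilon>) * \<theta> ^ i / 2"
  let ?a = "short_job B i" and ?b = "short_job (insert i B) i"
  have long: "?b = long_job B i" using \<open>i \<notin> B\<close> by (simp add: long_job_def short_job_def)
  have other: "j div 2 \<noteq> i" if "j \<notin> {?a, ?b}" for j
    using that long short_or_long_job[of j B] by auto
  have "0 < 1 - \<epsilon>" using theta_pos theta_le by simp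
  then have \<kappa>: "0 < ?\<kappa>" "?\<kappa> \<le> \<theta> ^ i"
    using eps_pos mult_right_mono[of "(1 - \<epsilon>) / 2" 1 "\<theta> ^ i"] by (simp_all add: less_imp_le)
  have "?\<kappa> < (1 - \<epsilon>) * job_size D j" if "j \<in> {?a, ?b}" for D j
    using that theta_power_le_job_size[of j D] job_size_pos[of D j] \<open>0 < 1 - \<epsilon>\<close> \<open>i < n\<close>
    by (auto simp: short_job_less)
  then have "processed (A (inst B)) ?a (phase_start (Suc i)) +
      processed (A (inst ?C)) ?b (phase_start (Suc i))
      \<le> 2 * (phase_start (Suc i) - phase_start i) - ?\<kappa>"
    using \<kappa> long \<open>i < n\<close>
    by (intro processed_indistinguishable_le[OF alg])
      (auto simp: valid_inst other job_size_insert short_job_neq_long_job arrival_eq_phase_start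
        short_job_less long_job_less phase_start_Suc)
  moreover have "4 * \<theta> ^ Suc i \<le> ?\<kappa>"
    using theta_le by simp
  moreover have "phase_start (Suc i) - phase_start i = \<theta> ^ i"
    by (simp add: phase_start_Suc)
  ultimately have "4 * \<theta> ^ Suc i \<le> remaining (inst B) (A (inst B)) ?a (phase_start (Suc i)) +
      remaining (inst ?C) (A (inst ?C)) ?b (phase_start (Suc i))"
    unfolding remaining_def inst_simps job_size_short_job[OF \<open>i < n\<close>] by argo
  then have "2 * \<theta> ^ Suc i \<le> remaining (inst B) (A (inst B)) ?a (phase_start (Suc i)) \<or>
      2 * \<theta> ^ Suc i \<le> remaining (inst ?C) (A (inst ?C)) ?b (phase_start (Suc i))" by linarith
  then show ?thesis using \<open>i < n\<close> by (simp add: missed_phases_def)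
qed

lemma leftoverI:
  assumes "measurable_schedule \<sigma>" and "i \<le> n" and "j < 2 * n"
    and "2 * \<theta> ^ i \<le> remaining (inst B) \<sigma> j (phase_start i)"
  shows "j \<in> leftover B \<sigma>"
proof -
  have "processed \<sigma> j (phase_start n) - processed \<sigma> j (phase_start i)
      \<le> phase_start n - phase_start i"
    using assms(1,2) by (intro processed_diff_le phase_start_mono)
  then have "\<theta> ^ n \<le> remaining (inst B) \<sigma> j (phase_start n)"
    using assms(4) phase_start_add_power_antimono[OF assms(2)] theta_power_pos[of n]
    unfolding remaining_def by linarith
  then show ?thesis using assms(3) by (simp add: leftover_def)
qed

lemma card_leftover_ge:
  assumes "feasible (inst B) \<sigma>"
  shows "n + card (missed_phases B \<sigma>) \<le> card (leftover B \<sigma>)"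
proof -
  let ?missed = "missed_phases B \<sigma>"
  note meas = feasible_imp_measurable_schedule[OF assms]
  have "long_job B i \<in> leftover B \<sigma>" if "i < n" for i
    using that processed_before_release[OF assms, of "phase_start i" "long_job B i"]
    by (intro leftoverI[OF meas, of i])
      (simp_all add: long_job_less remaining_def job_size_long_job arrival_eq_phase_start)
  moreover have "short_job B i \<in> leftover B \<sigma>" if "i \<in> ?missed" for i
    using that
    by (intro leftoverI[OF meas, of "Suc i"]) (simp_all add: short_job_less missed_phases_def)
  ultimately have "long_job B ` {..<n} \<union> short_job B ` ?missed \<subseteq> leftover B \<sigma>" by auto
  then have "card (long_job B ` {..<n} \<union> short_job B ` ?missed) \<le> card (leftover B \<sigma>)"
    by (intro card_mono) (auto simp: leftover_def)
  moreover have "long_job B ` {..<n} \<inter> short_job B ` ?missed = {}"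
    by (auto simp: disjoint_iff) (metis long_job_div_2 short_job_div_2 short_job_neq_long_job)
  moreover have "inj_on (long_job B) X" "inj_on (short_job B) X" for X
    by (metis inj_onI long_job_div_2, metis inj_onI short_job_div_2)
  moreover have "finite ?missed" by (simp add: missed_phases_def)
  ultimately show ?thesis by (simp add: card_Un_disjoint card_image)
qed

lemma remaining_stream_job:
  assumes "feasible (inst B) \<sigma>" and "2 * n \<le> j"
  shows "remaining (inst B) \<sigma> j (phase_start n) = \<theta> ^ n"
  using assms processed_before_release[of "inst B" \<sigma> "phase_start n" j] phase_start_le_arrival[of j]
  by (simp add: remaining_def job_size_def is_long_def phase_stream)

lemma arrival_stream_job_le:
  assumes "2 * n \<le> j" and "j \<le> 2 * n + m"
  shows "arrival j \<le> phase_start n + real m * \<theta> ^ n"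
proof -
  have "real (j - 2 * n) * \<theta> ^ n \<le> real m * \<theta> ^ n"
    using assms by (intro mult_right_mono) (auto simp: less_imp_le)
  then show ?thesis using assms(1) by (simp add: arrival_def phase_stream)
qed

text \<open>
  At every instant of the stream, more tiny jobs have arrived than jobs can have been completed
  since the stream began.
\<close>

lemma card_leftover_le_card_active:
  assumes feasible: "feasible (inst B) \<sigma>" and t: "t \<in> {phase_start n..<stream_end}"
  shows "card (leftover B \<sigma>) \<le> card (active_jobs (inst B) \<sigma> t)"
proof -
  let ?x = "(t - phase_start n) / \<theta> ^ n"
  define m where "m = nat \<lfloor>?x\<rfloor>"
  let ?J = "leftover B \<sigma> \<union> {2 * n..2 * n + m}"
  have "0 \<le> ?x" using t by (simp add: less_imp_le)
  then have m: "real m \<le> ?x" "?x < real m + 1" unfolding m_def by linarith+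
  moreover have "?x < real N"
    using t by (simp add: stream_end_def stream_length_def divide_less_eq)
  ultimately have "m < N" by linarith
  have "phase_start n + real m * \<theta> ^ n \<le> t"
    using m(1) by (simp add: le_divide_eq)
  then have released: "j \<in> jobs (inst B) \<and> release (inst B) j \<le> t" if "j \<in> ?J" for j
    using that t \<open>m < N\<close> arrival_le_phase_start[of j] arrival_stream_job_le[of j m]
    by (auto simp: leftover_def)
  have large: "\<theta> ^ n \<le> remaining (inst B) \<sigma> j (phase_start n)" if "j \<in> ?J" for j
    using that remaining_stream_job[OF feasible, of j] by (auto simp: leftover_def)
  have "phase_start n \<le> t" "finite ?J" "finite (jobs (inst B))"
    using t by (auto simp: leftover_def)
  from card_active_jobs_ge[OF feasible_imp_measurable_schedule[OF feasible] this(1)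
      theta_power_pos this(2,3) released large]
  have "real (card ?J) \<le> real (card (active_jobs (inst B) \<sigma> t)) + ?x" .
  moreover have "card ?J = card (leftover B \<sigma>) + Suc m"
    by (subst card_Un_disjoint) (auto simp: leftover_def)
  ultimately show ?thesis using m(2) by linarith
qed

lemma total_flow_time_inst_ge:
  assumes "feasible (inst B) \<sigma>"
  shows "ennreal (real (n + card (missed_phases B \<sigma>)) * stream_length)
    \<le> total_flow_time (inst B) \<sigma>"
proof -
  have "n + card (missed_phases B \<sigma>) \<le> card (active_jobs (inst B) \<sigma> t)"
    if "t \<in> {phase_start n..<stream_end}" for t
    using card_leftover_ge[OF assms] card_leftover_le_card_active[OF assms that]
    by (rule order_trans)
  then have "ennreal (real (n + card (missed_phases B \<sigma>)) * (stream_end - phase_start n))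
      \<le> total_flow_time (inst B) \<sigma>"
    using feasible_imp_measurable_schedule[OF assms]
    by (intro total_flow_time_ge_card_active valid_inst) (simp_all add: stream_end_def)
  then show ?thesis by (simp add: stream_end_def)
qed

lemma sum_card_missed_ge:
  assumes "clairvoyant_algorithm \<epsilon> A"
  shows "n * 2 ^ n \<le> 2 * (\<Sum>B\<in>Pow {..<n}. card (missed_phases B (A (inst B))))"
proof -
  let ?missed = "\<lambda>B. missed_phases B (A (inst B))"
  let ?m = "\<lambda>i. card {B \<in> Pow {..<n}. i \<in> ?missed B}"
  have card_missed: "card (?missed B) = card {i \<in> {..<n}. i \<in> ?missed B}" for B
    by (auto simp: missed_phases_def intro: arg_cong[where f = card])
  have "2 ^ n \<le> 2 * ?m i" if "i < n" for i
    using card_Pow_le_double_card[of "{..<n}" i] missed_phase_or_missed_insert[OF assms that] that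
    by simp
  then have "(\<Sum>i<n. 2 ^ n) \<le> (\<Sum>i<n. 2 * ?m i)"
    by (intro sum_mono) simp
  also have "\<dots> = 2 * (\<Sum>B\<in>Pow {..<n}. card {i \<in> {..<n}. i \<in> ?missed B})"
    by (subst sum_multicount_gen[where k = ?m]) (auto simp: sum_distrib_left)
  finally show ?thesis unfolding card_missed by simp
qed

lemma sum_total_flow_time_ge:
  assumes alg: "clairvoyant_algorithm \<epsilon> A"
  shows "of_nat (card (Pow {..<n})) * ennreal (3 / 2 * real n * stream_length)
    \<le> (\<Sum>B\<in>Pow {..<n}. total_flow_time (inst B) (A (inst B)))"
proof -
  let ?k = "\<lambda>B. n + card (missed_phases B (A (inst B)))"
  have "n * 2 ^ n + 2 * (n * 2 ^ n) \<le> 2 * (\<Sum>B\<in>Pow {..<n}. ?k B)"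
    using sum_card_missed_ge[OF alg] by (simp add: sum.distrib card_Pow)
  then have "real (n * 2 ^ n + 2 * (n * 2 ^ n)) \<le> real (2 * (\<Sum>B\<in>Pow {..<n}. ?k B))"
    by (simp only: of_nat_le_iff)
  then have "3 / 2 * real n * 2 ^ n \<le> (\<Sum>B\<in>Pow {..<n}. real (?k B))" by simp
  from mult_right_mono[OF this stream_length_nonneg]
  have "real (card (Pow {..<n})) * (3 / 2 * real n * stream_length)
      \<le> (\<Sum>B\<in>Pow {..<n}. real (?k B)) * stream_length"
    by (simp only: card_Pow finite_lessThan card_lessThan of_nat_power of_nat_numeral mult_ac)
  then have "of_nat (card (Pow {..<n})) * ennreal (3 / 2 * real n * stream_length)
      \<le> ennreal ((\<Sum>B\<in>Pow {..<n}. real (?k B)) * stream_length)"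
    unfolding ennreal_of_nat_eq_real_of_nat ennreal_mult'[OF of_nat_0_le_iff, symmetric]
    by (rule ennreal_leI)
  also have "\<dots> = (\<Sum>B\<in>Pow {..<n}. ennreal (real (?k B) * stream_length))"
    unfolding sum_distrib_right by (intro sum_ennreal[symmetric]) simp
  also have "\<dots> \<le> (\<Sum>B\<in>Pow {..<n}. total_flow_time (inst B) (A (inst B)))"
    using clairvoyant_algorithm_feasible[OF alg valid_inst]
    by (intro sum_mono total_flow_time_inst_ge)
  finally show ?thesis .
qed

end

subsection \<open>The competitive ratio\<close>

lemma exists_long_enough_stream:
  fixes r \<theta> c d :: real
  assumes "r < c" and "0 < \<theta>"
  obtains n N :: nat where
    "r * ((real n + 1) * (real N * \<theta> ^ n) + d * real n) < c * real n * (real N * \<theta> ^ n)"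
proof -
  obtain n :: nat where "r / (c - r) < real n" using reals_Archimedean2 by blast
  then have "r * (real n + 1) < c * real n" using assms(1) by (simp add: field_simps)
  then have gap: "0 < (c * real n - r * (real n + 1)) * \<theta> ^ n" (is "0 < ?gap")
    using assms(2) by simp
  obtain N :: nat where "r * (d * real n) / ?gap < real N" using reals_Archimedean2 by blast
  then have "r * (d * real n) < real N * ?gap" using gap by (simp add: field_simps)
  then have "r * ((real n + 1) * (real N * \<theta> ^ n) + d * real n) < c * real n * (real N * \<theta> ^ n)"
    by (simp add: algebra_simps)
  then show ?thesis using that by blast
qed

theorem theorem6p6:
  fixes \<epsilon> :: real
    and M :: "'w measure"
    and A :: "'w \<Rightarrow> scheduling_instance \<Rightarrow> schedule"
  assumes "0 < \<epsilon>" and "\<epsilon> < 1"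
    and "randomized_clairvoyant_algorithm \<epsilon> M A"
  shows "competitive_ratio_at_least (3 / 2) M A"
  unfolding competitive_ratio_at_least_def
proof (intro allI impI)
  fix \<rho>' :: real assume "\<rho>' < 3 / 2"
  let ?\<theta> = "(1 - \<epsilon>) / 8"
  have "max 0 \<rho>' < 3 / 2" "0 < ?\<theta>" using \<open>\<rho>' < 3 / 2\<close> \<open>\<epsilon> < 1\<close> by auto
  then obtain n N :: nat where dominates:
    "max 0 \<rho>' * ((real n + 1) * (real N * ?\<theta> ^ n) + 5 * real n)
      < 3 / 2 * real n * (real N * ?\<theta> ^ n)"
    by (rule exists_long_enough_stream)
  interpret adversary \<epsilon> ?\<theta> n N using assms(1,2) by unfold_locales auto
  let ?opt = "(real n + 1) * stream_length + 5 * real n" and ?alg = "3 / 2 * real n * stream_length"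
  obtain B where alg_ge: "ennreal ?alg \<le> expected_flow_time M A (inst B)"
    using expected_flow_time_ge_average[OF assms(3) _ _ valid_inst sum_total_flow_time_ge] by auto
  have "ennreal \<rho>' * opt_flow_time (inst B) \<le> ennreal (max 0 \<rho>') * ennreal ?opt"
    by (intro mult_mono opt_flow_time_inst_le ennreal_leI) auto
  also have "\<dots> = ennreal (max 0 \<rho>' * ?opt)"
    by (intro ennreal_mult'[symmetric]) simp
  also have "\<dots> < ennreal ?alg"
    using dominates[folded stream_length_def] by (subst ennreal_less_iff) simp_all
  finally show "\<exists>I. valid_instance I \<and> expected_flow_time M A I > ennreal \<rho>' * opt_flow_time I"
    using alg_ge valid_inst less_le_trans by blast
qed

end
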